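(* Let $(X,\mathcal{B}_X)$ be a bornological space, $(L,\mathcal{B}_L)$ a bornological group and $\rho$ a bornological $L$-action on $X$. Assume that the $L$-action $\rho$ on $X$ is bornological proper. Then there exists a coarse structure $\mathcal{E}$ on $X$ such that the equation $\mathcal{B}_X=\mathcal{B}_{\mathcal{E}}$ holds and the action $\rho$ on $(X,\mathcal{E})$ is equi controlled.
   Context: A bornology on a set $X$ is a family $\mathcal{B}$ of subsets of $X$ with $\bigcup_{B\in\mathcal{B}}B=X$ that is closed under unions of two members and under passing to subsets; $(X,\mathcal{B})$ is then a bornological space. A map between bornological spaces is bornological if the image of every member of the source bornology is a member of the target bornology. The direct product bornology on $X\times Y$ consists of all subsets of sets $B\times D$ with $B\in\mathcal{B}_X$, $D\in\mathcal{B}_Y$. A bornological group is a group $L$ with a bornology $\mathcal{B}_L$ such that multiplication $L\times L\to L$ (direct product bornology on $L\times L$) and inversion $L\to L$ are bornological maps. An $L$-action on $(X,\mathcal{B}_X)$ is bornological if the action map $L\times X\to X$, $(l,x)\mapsto lx$, is bornological (direct product bornology on $L\times X$). A bornological action $\rho$ is bornological proper if $L_{B,B'}:=\{l\in L\mid lB\cap B'\neq\emptyset\}\in\mathcal{B}_L$ for all $B,B'\in\mathcal{B}_X$. A coarse structure on $X$ is a family $\mathcal{E}$ of subsets of $X\times X$ containing $\mathrm{diag}(X)=\{(x,x)\mid x\in X\}$ and closed under transposition $E^T=\{(x',x)\mid (x,x')\in E\}$, unions of two members, compositions $E_1\circ E_2=\{(x,z)\mid \exists y\in X,\ (x,y)\in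 E_1,\ (y,z)\in E_2\}$, and subsets. For $E\subset X\times X$ and $A\subset X$, $E[A]=\{y\in X\mid \exists a\in A,\ (y,a)\in E\}$. The induced bornology is $\mathcal{B}_{\mathcal{E}}=\{B\subset X\mid \exists A\subset X\text{ finite},\ \exists E\in\mathcal{E},\ B\subset E[A]\}$. An $L$-action on $(X,\mathcal{E})$ is equi controlled if for each $E\in\mathcal{E}$ there is $F\in\mathcal{E}$ such that $E_l:=\{(lx,ly)\mid (x,y)\in E\}\subset F$ for every $l\in L$. *)

theory Defs
  imports "HOL-Algebra.Group_Action"
begin

text \<open>The family is required to be nonempty. This only matters for the empty set, where the other
  clauses would also admit the empty family; then \<open>{{}}\<close> is the only bornology on the empty set.\<close>

definition bornology :: "'x set \<Rightarrow> 'x set set \<Rightarrow> bool" where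
  "bornology X \<B> \<longleftrightarrow>
     \<B> \<subseteq> Pow X \<and> \<B> \<noteq> {} \<and> \<Union>\<B> = X \<and>
     (\<forall>B\<in>\<B>. \<forall>B'\<in>\<B>. B \<union> B' \<in> \<B>) \<and>
     (\<forall>B\<in>\<B>. \<forall>B'. B' \<subseteq> B \<longrightarrow> B' \<in> \<B>)"

text \<open>When the families are bornologies, the condition already forces the map to send the
  underlying set of the source into that of the target.\<close>

definition bornological_map :: "'x set set \<Rightarrow> 'y set set \<Rightarrow> ('x \<Rightarrow> 'y) \<Rightarrow> bool" where
  "bornological_map \<B> \<D> f \<longleftrightarrow> (\<forall>B\<in>\<B>. f ` B \<in> \<D>)"

definition product_bornology :: "'x set set \<Rightarrow> 'y set set \<Rightarrow> ('x \<times> 'y) set set" where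
  "product_bornology \<B> \<D> = {S. \<exists>B\<in>\<B>. \<exists>D\<in>\<D>. S \<subseteq> B \<times> D}"

definition bornological_group :: "('l, 'm) monoid_scheme \<Rightarrow> 'l set set \<Rightarrow> bool" where
  "bornological_group L \<B>\<^sub>L \<longleftrightarrow>
     group L \<and> bornology (carrier L) \<B>\<^sub>L \<and>
     bornological_map (product_bornology \<B>\<^sub>L \<B>\<^sub>L) \<B>\<^sub>L (\<lambda>(l, k). l \<otimes>\<^bsub>L\<^esub> k) \<and>
     bornological_map \<B>\<^sub>L \<B>\<^sub>L (\<lambda>l. inv\<^bsub>L\<^esub> l)"

definition bornological_action ::
  "('l, 'm) monoid_scheme \<Rightarrow> 'l set set \<Rightarrow> 'x set \<Rightarrow> 'x set set \<Rightarrow> ('l \<Rightarrow> 'x \<Rightarrow> 'x) \<Rightarrow> bool" where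
  "bornological_action L \<B>\<^sub>L X \<B> \<rho> \<longleftrightarrow>
     group_action L X \<rho> \<and>
     bornological_map (product_bornology \<B>\<^sub>L \<B>) \<B> (\<lambda>(l, x). \<rho> l x)"

definition bornological_proper ::
  "('l, 'm) monoid_scheme \<Rightarrow> 'l set set \<Rightarrow> 'x set set \<Rightarrow> ('l \<Rightarrow> 'x \<Rightarrow> 'x) \<Rightarrow> bool" where
  "bornological_proper L \<B>\<^sub>L \<B> \<rho> \<longleftrightarrow>
     (\<forall>B\<in>\<B>. \<forall>B'\<in>\<B>. {l \<in> carrier L. \<rho> l ` B \<inter> B' \<noteq> {}} \<in> \<B>\<^sub>L)"

definition coarse_structure :: "'x set \<Rightarrow> ('x \<times> 'x) set set \<Rightarrow> bool" where
  "coarse_structure X \<E> \<longleftrightarrow>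
     \<E> \<subseteq> Pow (X \<times> X) \<and> Id_on X \<in> \<E> \<and>
     (\<forall>E\<in>\<E>. E\<inverse> \<in> \<E>) \<and>
     (\<forall>E\<in>\<E>. \<forall>F\<in>\<E>. E \<union> F \<in> \<E>) \<and>
     (\<forall>E\<in>\<E>. \<forall>F\<in>\<E>. E O F \<in> \<E>) \<and>
     (\<forall>E\<in>\<E>. \<forall>F. F \<subseteq> E \<longrightarrow> F \<in> \<E>)"

text \<open>The set \<open>E[A]\<close>. The points of \<open>A\<close> are second components, so this is the image of \<open>A\<close>
  under the converse of \<open>E\<close>, not \<open>E `` A\<close>.\<close>

definition thickening :: "'x set \<Rightarrow> ('x \<times> 'x) set \<Rightarrow> 'x set \<Rightarrow> 'x set" where
  "thickening X E A = {y \<in> X. \<exists>a\<in>A. (y, a) \<in> E}"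

definition induced_bornology :: "'x set \<Rightarrow> ('x \<times> 'x) set set \<Rightarrow> 'x set set" where
  "induced_bornology X \<E> =
     {B. B \<subseteq> X \<and> (\<exists>A E. A \<subseteq> X \<and> finite A \<and> E \<in> \<E> \<and> B \<subseteq> thickening X E A)}"

definition equi_controlled ::
  "('l, 'm) monoid_scheme \<Rightarrow> ('x \<times> 'x) set set \<Rightarrow> ('l \<Rightarrow> 'x \<Rightarrow> 'x) \<Rightarrow> bool" where
  "equi_controlled L \<E> \<rho> \<longleftrightarrow>
     (\<forall>E\<in>\<E>. \<exists>F\<in>\<E>. \<forall>l\<in>carrier L. {(\<rho> l x, \<rho> l y) | x y. (x, y) \<in> E} \<subseteq> F)"

end

theory Submission
  imports Defs
begin

text \<open>
  The coarse structure is generated by the diagonal together with the translates \<open>lB \<times> lB\<close> of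
  squares of bounded sets: its entourages are the subsets of
  \<open>U\<^sub>B = diag(X) \<union> \<Union>\<^sub>l lB \<times> lB\<close> with \<open>B\<close> bounded. Each \<open>U\<^sub>B\<close> is invariant under the group, so the
  action is equi controlled at once.

  Properness enters through one observation. Write \<open>KB\<close> for the union of all \<open>gB\<close> that meet a
  bounded set \<open>C\<close>. The elements \<open>g\<close> in question form a bounded subset of the group by properness,
  and a bounded set of group elements moves \<open>B\<close> within a bounded set because the action is
  bornological; hence \<open>KB\<close> is bounded (\<open>bounded_saturation\<close>). This gives both nontrivial points.
  If \<open>lB\<close> and \<open>l'B'\<close> share a point, then \<open>l\<inverse>l'B'\<close> meets \<open>B\<close>, so \<open>l'B'\<close> lies in the \<open>l\<close>-translate
  of a bounded set that does not depend on \<open>l\<close> and \<open>l'\<close>; thus entourages compose. And the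
  \<open>U\<^sub>B\<close>-thickening of a finite set \<open>A\<close> consists of \<open>A\<close> and the translates of \<open>B\<close> that meet \<open>A\<close>,
  so it is bounded. Conversely a nonempty bounded \<open>B\<close> lies in the \<open>U\<^sub>B\<close>-thickening of any of its
  points.
\<close>

lemma finite_in_bornology:
  assumes "bornology X \<B>" "finite A" "A \<subseteq> X"
  shows "A \<in> \<B>"
  using assms(2,3)
proof (induction A rule: finite_induct)
  case empty
  then show ?case using assms(1) unfolding bornology_def by blast
next
  case (insert a A)
  obtain B where "B \<in> \<B>" "a \<in> B"
    using insert.prems assms(1) unfolding bornology_def by blast
  then have "B \<union> A \<in> \<B>"
    using insert assms(1) unfolding bornology_def by simp
  moreover have "insert a A \<subseteq> B \<union> A"
    using \<open>a \<in> B\<close> by blast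
  ultimately show ?case
    using assms(1) unfolding bornology_def by blast
qed

definition saturation ::
  "('l, 'm) monoid_scheme \<Rightarrow> ('l \<Rightarrow> 'x \<Rightarrow> 'x) \<Rightarrow> 'x set \<Rightarrow> 'x set \<Rightarrow> 'x set" where
  "saturation L \<rho> B C = \<Union> {\<rho> l ` B | l. l \<in> carrier L \<and> \<rho> l ` B \<inter> C \<noteq> {}}"

text \<open>The diagonal is added because the translates of \<open>B\<close> need not cover \<open>X\<close>.\<close>

definition orbit_entourage ::
  "('l, 'm) monoid_scheme \<Rightarrow> 'x set \<Rightarrow> ('l \<Rightarrow> 'x \<Rightarrow> 'x) \<Rightarrow> 'x set \<Rightarrow> ('x \<times> 'x) set" where
  "orbit_entourage L X \<rho> B = Id_on X \<union> (\<Union>l\<in>carrier L. \<rho> l ` B \<times> \<rho> l ` B)"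

text \<open>The translations that contribute to the saturation form a bounded set \<open>K\<close> by properness, and
  the saturation is the image of \<open>K \<times> B\<close> under the action map.\<close>

lemma bounded_saturation:
  assumes "bornological_action L \<B>\<^sub>L X \<B> \<rho>" "bornological_proper L \<B>\<^sub>L \<B> \<rho>"
    and "B \<in> \<B>" "C \<in> \<B>"
  shows "saturation L \<rho> B C \<in> \<B>"
proof -
  define K where "K = {l \<in> carrier L. \<rho> l ` B \<inter> C \<noteq> {}}"
  have "K \<in> \<B>\<^sub>L"
    using assms(2-4) unfolding bornological_proper_def K_def by blast
  then have "K \<times> B \<in> product_bornology \<B>\<^sub>L \<B>"
    using assms(3) unfolding product_bornology_def by blast
  then have "(\<lambda>(l, x). \<rho> l x) ` (K \<times> B) \<in> \<B>"
    using assms(1) unfolding bornological_action_def bornological_map_def by blast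
  moreover have "(\<lambda>(l, x). \<rho> l x) ` (K \<times> B) = saturation L \<rho> B C"
    unfolding saturation_def K_def by force
  ultimately show ?thesis by simp
qed

lemma orbit_entourage_mono:
  "B \<subseteq> C \<Longrightarrow> orbit_entourage L X \<rho> B \<subseteq> orbit_entourage L X \<rho> C"
  unfolding orbit_entourage_def by blast

lemma converse_orbit_entourage:
  "(orbit_entourage L X \<rho> B)\<inverse> = orbit_entourage L X \<rho> B"
  unfolding orbit_entourage_def by blast

lemma thickening_orbit_entourage_subset:
  "thickening X (orbit_entourage L X \<rho> B) A \<subseteq> A \<union> saturation L \<rho> B A"
  unfolding thickening_def orbit_entourage_def saturation_def by blast

context group_action
begin

lemma translate_image_mult:
  assumes "B \<subseteq> E" "l \<in> carrier G" "k \<in> carrier G"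
  shows "\<phi> l ` \<phi> k ` B = \<phi> (l \<otimes> k) ` B"
proof -
  have "\<phi> l (\<phi> k x) = \<phi> (l \<otimes> k) x" if "x \<in> B" for x
    using composition_rule[of x l k] that assms by auto
  then show ?thesis by (simp add: image_image)
qed

lemma orbit_entourage_subset:
  assumes "B \<subseteq> E"
  shows "orbit_entourage G E \<phi> B \<subseteq> E \<times> E"
  using assms element_image unfolding orbit_entourage_def by fastforce

lemma orbit_entourage_invariant:
  assumes B: "B \<subseteq> E" and l: "l \<in> carrier G" and xy: "(x, y) \<in> orbit_entourage G E \<phi> B"
  shows "(\<phi> l x, \<phi> l y) \<in> orbit_entourage G E \<phi> B"
proof (cases "(x, y) \<in> Id_on E")
  case True
  then show ?thesis
    using element_image[OF l] unfolding orbit_entourage_def by blast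
next
  case False
  then obtain k where k: "k \<in> carrier G" "x \<in> \<phi> k ` B" "y \<in> \<phi> k ` B"
    using xy unfolding orbit_entourage_def by blast
  then have "\<phi> l x \<in> \<phi> (l \<otimes> k) ` B" "\<phi> l y \<in> \<phi> (l \<otimes> k) ` B"
    using translate_image_mult[OF B l] by blast+
  moreover have "l \<otimes> k \<in> carrier G"
    using group_hom l k(1) by (simp add: group_hom_def group.subgroup_self subgroup.m_closed)
  ultimately show ?thesis unfolding orbit_entourage_def by blast
qed

text \<open>If \<open>y\<close> is common to \<open>lB\<close> and \<open>kC\<close>, then \<open>g = l\<inverse>k\<close> moves \<open>C\<close> to a set meeting \<open>B\<close>. So
  \<open>gC\<close> is contained in the saturation and \<open>kC = lgC\<close> in its translate by \<open>l\<close>.\<close>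

lemma orbit_entourage_comp_subset:
  assumes B: "B \<subseteq> E" and C: "C \<subseteq> E"
  shows "orbit_entourage G E \<phi> B O orbit_entourage G E \<phi> C
    \<subseteq> orbit_entourage G E \<phi> (B \<union> C \<union> saturation G \<phi> C B)" (is "_ \<subseteq> ?R")
proof (rule subrelI)
  interpret G: group G using group_hom by (simp add: group_hom_def)
  fix x z
  assume "(x, z) \<in> orbit_entourage G E \<phi> B O orbit_entourage G E \<phi> C"
  then obtain y where xy: "(x, y) \<in> orbit_entourage G E \<phi> B"
    and yz: "(y, z) \<in> orbit_entourage G E \<phi> C" by blast
  show "(x, z) \<in> ?R"
  proof (cases "x = y \<or> y = z")
    case True
    then show ?thesis
      using xy yz orbit_entourage_mono[of B "B \<union> C \<union> saturation G \<phi> C B"]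
        orbit_entourage_mono[of C "B \<union> C \<union> saturation G \<phi> C B"] by blast
  next
    case False
    then obtain l k where l: "l \<in> carrier G" "x \<in> \<phi> l ` B" "y \<in> \<phi> l ` B"
      and k: "k \<in> carrier G" "y \<in> \<phi> k ` C" "z \<in> \<phi> k ` C"
      using xy yz unfolding orbit_entourage_def by blast
    define g where "g = inv l \<otimes> k"
    have g: "g \<in> carrier G" using l k unfolding g_def by simp
    have lg: "l \<otimes> g = k"
      using l(1) k(1) unfolding g_def by (simp add: G.m_assoc[symmetric])
    have kC: "\<phi> k ` C = \<phi> l ` \<phi> g ` C"
      using translate_image_mult[OF C l(1) g] lg by simp
    obtain b c where b: "b \<in> B" "y = \<phi> l b" and c: "c \<in> \<phi> g ` C" "y = \<phi> l c"
      using l(3) k(2) kC by blast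
    have "b = c"
      using b c B C element_image[OF g] inj_prop[OF l(1)] by (metis imageE inj_onD subsetD)
    then have "\<phi> g ` C \<subseteq> saturation G \<phi> C B"
      using b(1) c(1) g unfolding saturation_def by blast
    then have "z \<in> \<phi> l ` saturation G \<phi> C B"
      using k(3) kC by blast
    then show ?thesis
      using l(1,2) unfolding orbit_entourage_def by blast
  qed
qed

end

theorem theorem1p14:
  fixes X :: "'x set" and \<B>\<^sub>X :: "'x set set"
    and L :: "('l, 'm) monoid_scheme" and \<B>\<^sub>L :: "'l set set"
    and \<rho> :: "'l \<Rightarrow> 'x \<Rightarrow> 'x"
  assumes "bornology X \<B>\<^sub>X"
    and "bornological_group L \<B>\<^sub>L"
    and "bornological_action L \<B>\<^sub>L X \<B>\<^sub>X \<rho>"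
    and "bornological_proper L \<B>\<^sub>L \<B>\<^sub>X \<rho>"
  shows "\<exists>\<E>. coarse_structure X \<E> \<and> \<B>\<^sub>X = induced_bornology X \<E> \<and> equi_controlled L \<E> \<rho>"
proof -
  interpret group_action L X \<rho>
    using assms(3) unfolding bornological_action_def by simp
  interpret L: group L using group_hom by (simp add: group_hom_def)
  let ?U = "orbit_entourage L X \<rho>"
  define \<E> where "\<E> = {E. \<exists>B\<in>\<B>\<^sub>X. E \<subseteq> ?U B}"
  have un: "B \<union> C \<in> \<B>\<^sub>X" if "B \<in> \<B>\<^sub>X" "C \<in> \<B>\<^sub>X" for B C
    using assms(1) that unfolding bornology_def by blast
  have down: "C \<in> \<B>\<^sub>X" if "B \<in> \<B>\<^sub>X" "C \<subseteq> B" for B C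
    using assms(1) that unfolding bornology_def by blast
  have sub: "B \<subseteq> X" if "B \<in> \<B>\<^sub>X" for B
    using assms(1) that unfolding bornology_def by blast
  have empty: "{} \<in> \<B>\<^sub>X"
    using finite_in_bornology[OF assms(1)] by simp
  note sat = bounded_saturation[OF assms(3,4)]
  have U: "?U B \<in> \<E>" if "B \<in> \<B>\<^sub>X" for B
    using that unfolding \<E>_def by blast
  have "coarse_structure X \<E>"
    unfolding coarse_structure_def
  proof (intro conjI ballI allI impI)
    show "\<E> \<subseteq> Pow (X \<times> X)"
      using orbit_entourage_subset sub unfolding \<E>_def by blast
    show "Id_on X \<in> \<E>"
      using empty unfolding \<E>_def orbit_entourage_def by blast
  next
    fix E assume "E \<in> \<E>"
    then show "E\<inverse> \<in> \<E>"
      using converse_orbit_entourage unfolding \<E>_def by blast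
  next
    fix E F assume "E \<in> \<E>" "F \<in> \<E>"
    then obtain B C where B: "B \<in> \<B>\<^sub>X" "E \<subseteq> ?U B" and C: "C \<in> \<B>\<^sub>X" "F \<subseteq> ?U C"
      unfolding \<E>_def by blast
    have "E \<union> F \<subseteq> ?U (B \<union> C)"
      using B(2) C(2) orbit_entourage_mono[of B "B \<union> C"] orbit_entourage_mono[of C "B \<union> C"]
      by blast
    then show "E \<union> F \<in> \<E>"
      using un[OF B(1) C(1)] unfolding \<E>_def by blast
    have "E O F \<subseteq> ?U (B \<union> C \<union> saturation L \<rho> C B)"
      using relcomp_mono[OF B(2) C(2)] orbit_entourage_comp_subset[OF sub[OF B(1)] sub[OF C(1)]]
      by (rule subset_trans)
    then show "E O F \<in> \<E>"
      using un[OF un[OF B(1) C(1)] sat[OF C(1) B(1)]] unfolding \<E>_def by blast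
  next
    fix E F assume "E \<in> \<E>" "F \<subseteq> E"
    then show "F \<in> \<E>" unfolding \<E>_def by blast
  qed
  moreover have "\<B>\<^sub>X = induced_bornology X \<E>"
  proof
    show "\<B>\<^sub>X \<subseteq> induced_bornology X \<E>"
    proof
      fix B assume B: "B \<in> \<B>\<^sub>X"
      show "B \<in> induced_bornology X \<E>"
      proof (cases "B = {}")
        case True
        then show ?thesis
          using U[OF B] unfolding induced_bornology_def by blast
      next
        case False
        then obtain a where a: "a \<in> B" by blast
        have "\<rho> \<one>\<^bsub>L\<^esub> ` B = B"
          using sub[OF B] by (auto simp: id_eq_one[symmetric])
        then have "B \<times> B \<subseteq> ?U B"
          using L.one_closed unfolding orbit_entourage_def by blast
        then have "B \<subseteq> thickening X (?U B) {a}"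
          using a sub[OF B] unfolding thickening_def by blast
        moreover have "{a} \<subseteq> X" "finite {a}"
          using a sub[OF B] by auto
        ultimately show ?thesis
          using U[OF B] sub[OF B] unfolding induced_bornology_def by blast
      qed
    qed
    show "induced_bornology X \<E> \<subseteq> \<B>\<^sub>X"
    proof
      fix D assume "D \<in> induced_bornology X \<E>"
      then obtain A E B where A: "A \<subseteq> X" "finite A" and B: "B \<in> \<B>\<^sub>X" "E \<subseteq> ?U B"
        and D: "D \<subseteq> thickening X E A"
        unfolding induced_bornology_def \<E>_def by blast
      have "D \<subseteq> thickening X (?U B) A"
        using B(2) D unfolding thickening_def by blast
      then have "D \<subseteq> A \<union> saturation L \<rho> B A"
        using thickening_orbit_entourage_subset by (rule subset_trans)
      moreover have "A \<in> \<B>\<^sub>X"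
        using finite_in_bornology[OF assms(1) A(2,1)] .
      ultimately show "D \<in> \<B>\<^sub>X"
        using down un sat[OF B(1)] by blast
    qed
  qed
  moreover have "equi_controlled L \<E> \<rho>"
    unfolding equi_controlled_def
  proof
    fix E assume "E \<in> \<E>"
    then obtain B where B: "B \<in> \<B>\<^sub>X" "E \<subseteq> ?U B"
      unfolding \<E>_def by blast
    then have "\<forall>l\<in>carrier L. {(\<rho> l x, \<rho> l y) | x y. (x, y) \<in> E} \<subseteq> ?U B"
      using orbit_entourage_invariant[OF sub[OF B(1)]] by blast
    then show "\<exists>F\<in>\<E>. \<forall>l\<in>carrier L. {(\<rho> l x, \<rho> l y) | x y. (x, y) \<in> E} \<subseteq> F"
      using U[OF B(1)] by blast
  qed
  ultimately show ?thesis by blast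
qed

end
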